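(* Let $n,k\ge2$ and $t\ge1$ be integers, and let $\mathcal{F}\subset\binom{[n]}{k}$ be $t$-intersecting. Let $q,\tau\ge1$ satisfy $n>2^{12}\tau k\log_2(2k)$, $n\ge 2q\tau k$ and $q\ge t$. Then there exist a $t$-intersecting family $\mathcal{S}$ of subsets of $[n]$, each of size at most $q$, and a family $\mathcal{F}'$ such that: (i) for every $A\in\mathcal{F}\setminus\mathcal{F}'$ there is $B\in\mathcal{S}$ with $B\subset A$; (ii) for every $B\in\mathcal{S}$ there is a family $\mathcal{F}_B\subset\mathcal{F}$ such that $\mathcal{F}_B(B)$ is $\tau$-homogeneous (as a family in $\binom{[n]\setminus B}{k-|B|}$); (iii) $|\mathcal{F}'|\le\tau^{-q-1}\binom{n}{k}$.
   Context: A family is $t$-intersecting if any two of its members (not necessarily distinct) share at least $t$ elements. For a family $\mathcal{G}$ and a set $S$, $\mathcal{G}(S)=\{A\setminus S: A\in\mathcal{G},\ S\subset A\}$. For a ground set $X$ with $|X|=N$ and $\tau>1$ (or $\tau\ge 1$), a family $\mathcal{G}\subset\binom{X}{m}$ is $\tau$-homogeneous if for every $A\subset X$ of size $a\le m$ we have $|\mathcal{G}(A)|\le\tau^{a}\frac{\binom{N-a}{m-a}}{\binom{N}{m}}|\mathcal{G}|$.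
   Formalization: q is taken to be an integer; for non-integer q the bound (iii) can fail (e.g. k=2, t=1, q=3/2, n=2^80, τ=2^65 and the family {12,13,23}). *)

theory Defs
  imports Complex_Main "HOL-Library.Ramsey"
begin

definition t_intersecting :: "nat \<Rightarrow> 'a set set \<Rightarrow> bool" where
  "t_intersecting t F \<longleftrightarrow> (\<forall>A\<in>F. \<forall>B\<in>F. t \<le> card (A \<inter> B))"

text \<open>The family written $\mathcal{G}(S)$.\<close>

definition link :: "'a set set \<Rightarrow> 'a set \<Rightarrow> 'a set set" where
  "link G S = {A - S | A. A \<in> G \<and> S \<subseteq> A}"

definition homogeneous :: "real \<Rightarrow> 'a set \<Rightarrow> nat \<Rightarrow> 'a set set \<Rightarrow> bool" where
  "homogeneous \<tau> X m G \<longleftrightarrow>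
     G \<subseteq> nsets X m \<and>
     (\<forall>A. A \<subseteq> X \<and> card A \<le> m \<longrightarrow>
        real (card (link G A)) \<le>
          \<tau> ^ card A
          * (real ((card X - card A) choose (m - card A)) / real (card X choose m))
          * real (card G))"

end

theory Submission
  imports Defs
begin

text \<open>Repeatedly take a largest set \<open>B\<close> on which the current family has density at least
  \<open>\<tau> ^ card B\<close> times the expected one, and strip off the members containing \<open>B\<close>; maximality makes the
  link at \<open>B\<close> homogeneous. Once \<open>card B > q\<close>, the trivial bound on the size of a link shows that what is
  left is small. If two of the kernels, \<open>B\<close> and \<open>C\<close>, met in fewer than \<open>t\<close> points, pass to the members of
  the link at \<open>B\<close> avoiding \<open>C\<close> and vice versa (at least half survive). Both families are spread, so a
  uniformly random set contains a member of each with probability more than \<open>1/2\<close>. Hence some set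
  contains a member of one family while its complement contains a member of the other, which
  contradicts \<open>t\<close>-intersection.

  The spread lemma is proved by revealing the random set in \<open>L\<close> rounds. In each round a member is
  replaced by its minimal fragment, i.e. the smallest remainder of a member contained in it
  and the revealed set; for most members the size bound \<open>2 ^ L\<close> halves.\<close>

subsection \<open>Random subsets\<close>

text \<open>Expectation of \<open>f W\<close> when every point of \<open>X\<close> enters
  \<open>W\<close> independently with probability \<open>p\<close>. Written as a finite sum, it
  makes sense for every real \<open>p\<close>, and identities need no bounds on
  \<open>p\<close>.\<close>

definition subset_exp :: "'a set \<Rightarrow> real \<Rightarrow> ('a set \<Rightarrow> real) \<Rightarrow> real" where
  "subset_exp X p f = (\<Sum>W\<in>Pow X. p ^ card W * (1 - p) ^ card (X - W) * f W)"

lemma subset_exp_empty [simp]: "subset_exp {} p f = f {}"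
  by (simp add: subset_exp_def)

text \<open>Condition on whether \<open>x\<close> is drawn. This recursion drives the inductions on
  \<open>X\<close>.\<close>

lemma subset_exp_insert:
  assumes "finite X" "x \<notin> X"
  shows "subset_exp (insert x X) p f
    = (1 - p) * subset_exp X p f + p * subset_exp X p (\<lambda>W. f (insert x W))"
proof -
  let ?g = "\<lambda>W. p ^ card W * (1 - p) ^ card (insert x X - W) * f W"
  have "subset_exp (insert x X) p f = sum ?g (Pow X) + sum ?g (insert x ` Pow X)"
    unfolding subset_exp_def Pow_insert using assms
    by (intro sum.union_disjoint) auto
  moreover have "sum ?g (Pow X) = (1 - p) * subset_exp X p f"
    unfolding subset_exp_def sum_distrib_left
  proof (rule sum.cong[OF refl])
    fix W assume "W \<in> Pow X"
    then have "insert x X - W = insert x (X - W)" "x \<notin> X - W" "finite (X - W)"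
      using assms by auto
    then show "?g W = (1 - p) * (p ^ card W * (1 - p) ^ card (X - W) * f W)"
      by simp
  qed
  moreover have "sum ?g (insert x ` Pow X) = p * subset_exp X p (\<lambda>W. f (insert x W))"
  proof -
    have "inj_on (insert x) (Pow X)"
      using assms by (auto simp: inj_on_def insert_eq_iff dest!: subsetD)
    then have "sum ?g (insert x ` Pow X) = (\<Sum>W\<in>Pow X. ?g (insert x W))"
      by (simp add: sum.reindex)
    also have "\<dots> = (\<Sum>W\<in>Pow X. p * (p ^ card W * (1 - p) ^ card (X - W) * f (insert x W)))"
    proof (rule sum.cong[OF refl])
      fix W assume "W \<in> Pow X"
      then have "insert x X - insert x W = X - W" "x \<notin> W" "finite W"
        using assms by (auto intro: finite_subset)
      then show "?g (insert x W) = p * (p ^ card W * (1 - p) ^ card (X - W) * f (insert x W))"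
        by simp
    qed
    finally show ?thesis
      by (simp add: subset_exp_def sum_distrib_left)
  qed
  ultimately show ?thesis by simp
qed

lemma subset_exp_const: "finite X \<Longrightarrow> subset_exp X p (\<lambda>_. c) = c"
  by (induction X rule: finite_induct) (simp_all add: subset_exp_insert algebra_simps)

lemma subset_exp_add:
  "subset_exp X p (\<lambda>W. f W + g W) = subset_exp X p f + subset_exp X p g"
  by (simp add: subset_exp_def sum.distrib algebra_simps)

lemma subset_exp_cmult: "subset_exp X p (\<lambda>W. c * f W) = c * subset_exp X p f"
  by (simp add: subset_exp_def sum_distrib_left mult_ac)

lemma subset_exp_mono:
  assumes "0 \<le> p" "p \<le> 1" "\<And>W. W \<subseteq> X \<Longrightarrow> f W \<le> g W"
  shows "subset_exp X p f \<le> subset_exp X p g"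
  unfolding subset_exp_def using assms by (intro sum_mono mult_left_mono) auto

lemma subset_exp_zero_prob: "finite X \<Longrightarrow> subset_exp X 0 f = f {}"
  by (induction X rule: finite_induct) (simp_all add: subset_exp_insert)

text \<open>A point escapes two independent draws with probability \<open>(1 - p) * (1 - q)\<close>,
  so the union of the two random sets is again a random set, of the combined density.\<close>

lemma subset_exp_Un:
  assumes "finite X"
  shows "subset_exp X (1 - (1 - p) * (1 - q)) f
    = subset_exp X p (\<lambda>V. subset_exp X q (\<lambda>W. f (V \<union> W)))"
  using assms
proof (induction X arbitrary: f rule: finite_induct)
  case empty
  show ?case by simp
next
  case (insert x X)
  define a where "a = subset_exp X p (\<lambda>V. subset_exp X q (\<lambda>W. f (V \<union> W)))"
  define b where "b = subset_exp X p (\<lambda>V. subset_exp X q (\<lambda>W. f (insert x (V \<union> W))))"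
  have "subset_exp (insert x X) p (\<lambda>V. subset_exp (insert x X) q (\<lambda>W. f (V \<union> W)))
     = (1 - p) * ((1 - q) * a + q * b) + p * ((1 - q) * b + q * b)"
    using insert.hyps
    by (simp add: subset_exp_insert subset_exp_add subset_exp_cmult a_def b_def)
      (simp add: algebra_simps)
  moreover have "subset_exp (insert x X) (1 - (1 - p) * (1 - q)) f
     = (1 - p) * (1 - q) * a + (1 - (1 - p) * (1 - q)) * b"
    using insert by (simp add: subset_exp_insert a_def b_def)
  ultimately show ?case by (simp add: algebra_simps)
qed

text \<open>At density 1/2 all subsets of \<open>X\<close> have the same weight, and complementation
  permutes them.\<close>

lemma subset_exp_half_compl:
  assumes "finite X"
  shows "subset_exp X (1/2) (\<lambda>W. f (X - W)) = subset_exp X (1/2) f"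
proof -
  have *: "(1/2::real) ^ card W * (1 - 1/2) ^ card (X - W) = (1/2) ^ card X" if "W \<subseteq> X" for W
  proof -
    have "card W + card (X - W) = card X"
      using that assms by (metis card_Diff_subset card_mono finite_subset le_add_diff_inverse)
    then show ?thesis by (simp flip: power_add)
  qed
  have "subset_exp X (1/2) (\<lambda>W. f (X - W)) = (\<Sum>W\<in>Pow X. (1/2) ^ card X * f (X - W))"
    unfolding subset_exp_def using * by (intro sum.cong) auto
  also have "\<dots> = (\<Sum>W\<in>Pow X. (1/2) ^ card X * f W)"
    by (rule sum.reindex_bij_witness[of _ "\<lambda>W. X - W" "\<lambda>W. X - W"]) (auto simp: double_diff)
  also have "\<dots> = subset_exp X (1/2) f"
    unfolding subset_exp_def using * by (intro sum.cong) auto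
  finally show ?thesis .
qed

subsection \<open>Spread families\<close>

text \<open>Each pair of a set \<open>W\<close> and an index \<open>i\<close> with a large fragment
  is recorded as \<open>Z = W \<union> \<phi> W i\<close>, the fragment \<open>B\<close>, and
  \<open>i\<close>. Given \<open>Z\<close> there are at most \<open>2 ^ K\<close> choices for
  \<open>B\<close>, then at most \<open>N / r ^ card B\<close> for \<open>i\<close>, while passing
  from \<open>W\<close> to \<open>Z\<close> costs a factor \<open>1 / p ^ card B\<close> in weight.
  Members are indexed because different ones may have equal fragments.\<close>

lemma fragment_bound:
  fixes T :: "'b \<Rightarrow> 'a set" and N p r :: real
  assumes "finite X" "finite I" and p: "0 < p" "p \<le> 1" and pr: "1 \<le> p * r"
    and T: "\<And>i. i \<in> I \<Longrightarrow> T i \<subseteq> X" "\<And>i. i \<in> I \<Longrightarrow> card (T i) \<le> K"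
    and spread: "\<And>A. A \<subseteq> X \<Longrightarrow> real (card {i \<in> I. A \<subseteq> T i}) \<le> N / r ^ card A"
  obtains \<phi> where
    "\<And>W i. i \<in> I \<Longrightarrow> \<phi> W i \<subseteq> T i"
    "\<And>W i. i \<in> I \<Longrightarrow> \<exists>j\<in>I. T j \<subseteq> W \<union> \<phi> W i"
    "subset_exp X p (\<lambda>W. real (card {i \<in> I. m \<le> card (\<phi> W i)})) \<le> 2 ^ K * N / (p * r) ^ m"
proof -
  have r: "0 < r" using p pr by (smt (verit) mult_nonneg_nonpos)
  have N: "0 \<le> N" using spread[of "{}"] by simp
  \<comment> \<open>Among the members inside \<open>W \<union> T i\<close>, \<open>c W i\<close>
    indexes one with the fewest points outside \<open>W\<close>; \<open>i\<close> itself competes,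
    so a minimum exists.\<close>
  define c where "c W i = (ARG_MIN (\<lambda>j. card (T j - W)) j. j \<in> I \<and> T j \<subseteq> W \<union> T i)" for W i
  have c: "c W i \<in> I" "T (c W i) \<subseteq> W \<union> T i"
      "\<And>j. j \<in> I \<Longrightarrow> T j \<subseteq> W \<union> T i \<Longrightarrow> card (T (c W i) - W) \<le> card (T j - W)"
    if "i \<in> I" for W i
    using arg_min_nat_lemma[of "\<lambda>j. j \<in> I \<and> T j \<subseteq> W \<union> T i" i "\<lambda>j. card (T j - W)"] that
    unfolding c_def by auto
  define \<phi> where "\<phi> W i = T (c W i) - W" for W i
  have \<phi>1: "\<phi> W i \<subseteq> T i" if "i \<in> I" for W i
    using c(2)[OF that, of W] by (auto simp: \<phi>_def)
  have \<phi>2: "\<exists>j\<in>I. T j \<subseteq> W \<union> \<phi> W i" if "i \<in> I" for W i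
    using c(1)[OF that, of W] by (auto simp: \<phi>_def)
  \<comment> \<open>The selection sees only \<open>Z\<close>, not \<open>W\<close> or
    \<open>i\<close>. The default \<open>{}\<close> keeps the bounds on \<open>e Z\<close> valid for
    every \<open>Z\<close>.\<close>
  define e where "e Z = (if \<exists>j\<in>I. T j \<subseteq> Z then T (SOME j. j \<in> I \<and> T j \<subseteq> Z) else {})" for Z
  have e_sub: "e Z \<subseteq> X" "finite (e Z)" "card (e Z) \<le> K" for Z
  proof -
    have "e Z \<subseteq> X \<and> card (e Z) \<le> K"
    proof (cases "\<exists>j\<in>I. T j \<subseteq> Z")
      case True
      then have "(SOME j. j \<in> I \<and> T j \<subseteq> Z) \<in> I"
        by (metis (mono_tags, lifting) someI_ex)
      with True show ?thesis using T by (auto simp: e_def)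
    qed (simp add: e_def)
    then show "e Z \<subseteq> X" "card (e Z) \<le> K" by auto
    then show "finite (e Z)" using \<open>finite X\<close> finite_subset by blast
  qed
  text \<open>Given only \<open>Z = W \<union> \<phi> W i\<close>, minimality forces the fragment \<open>\<phi> W i\<close> to be a subset of the
    member \<open>e Z\<close> selected inside \<open>Z\<close>, which leaves at most \<open>2 ^ K\<close> choices for it.\<close>
  have \<phi>_e: "\<phi> W i \<subseteq> e (W \<union> \<phi> W i)" if i: "i \<in> I" for W i
  proof -
    let ?Z = "W \<union> \<phi> W i"
    obtain j where j: "j \<in> I" "T j \<subseteq> ?Z" "e ?Z = T j"
      using \<phi>2[OF i, of W] by (metis (mono_tags, lifting) e_def someI_ex)
    have "T j \<subseteq> W \<union> T i" using j(2) \<phi>1[OF i, of W] by blast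
    then have "card (\<phi> W i) \<le> card (T j - W)" using c(3)[OF i j(1)] by (simp add: \<phi>_def)
    moreover have "T j - W \<subseteq> \<phi> W i" using j(2) by blast
    moreover have "finite (\<phi> W i)"
      using \<phi>1[OF i] T(1)[OF i] \<open>finite X\<close> by (meson finite_subset)
    ultimately have "T j - W = \<phi> W i" by (meson card_seteq)
    then show ?thesis using j(3) by blast
  qed
  define \<mu> where "\<mu> W = p ^ card W * (1 - p) ^ card (X - W)" for W
  have \<mu>0: "0 \<le> \<mu> W" for W using p by (simp add: \<mu>_def)
  \<comment> \<open>Moving \<open>B\<close> into the random set trades the factor
    \<open>(1 - p) ^ card B\<close> for \<open>p ^ card B\<close>; bounding the former by 1 avoids a
    division by \<open>1 - p\<close>, which may be 0.\<close>
  have \<mu>_shift: "\<mu> W \<le> \<mu> (W \<union> B) / p ^ card B" if "W \<subseteq> X" "B \<subseteq> X" "W \<inter> B = {}" for W B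
  proof -
    have fin: "finite W" "finite B" using that \<open>finite X\<close> finite_subset by blast+
    have "card (W \<union> B) = card W + card B" using fin that(3) by (simp add: card_Un_disjoint)
    moreover have "card (X - W) = card (X - (W \<union> B)) + card B"
    proof -
      have "X - W = (X - (W \<union> B)) \<union> B" using that by blast
      moreover have "card ((X - (W \<union> B)) \<union> B) = card (X - (W \<union> B)) + card B"
        using fin \<open>finite X\<close> by (intro card_Un_disjoint) auto
      ultimately show ?thesis by simp
    qed
    ultimately have "\<mu> (W \<union> B) / p ^ card B = p ^ card W * (1 - p) ^ card (X - (W \<union> B))"
      "\<mu> W = p ^ card W * (1 - p) ^ card (X - (W \<union> B)) * (1 - p) ^ card B"
      using p by (simp_all add: \<mu>_def power_add)
    moreover have "(1 - p) ^ card B \<le> 1" using p by (simp add: power_le_one)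
    ultimately show ?thesis using p
      by (metis diff_ge_0_iff_ge less_eq_real_def mult_left_le mult_nonneg_nonneg zero_le_power)
  qed
  define D where "D = (SIGMA W:Pow X. {i \<in> I. m \<le> card (\<phi> W i)})"
  define D' where "D' = (SIGMA Z:Pow X. SIGMA B:{B\<in>Pow (e Z). m \<le> card B}. {i \<in> I. B \<subseteq> T i})"
  \<comment> \<open>Fragments are disjoint from \<open>W\<close>, so \<open>W = Z - B\<close> is
    recovered and the encoding is injective.\<close>
  define g where "g = (\<lambda>(W, i). (W \<union> \<phi> W i, \<phi> W i, i))"
  have finD': "finite D'"
    using \<open>finite X\<close> \<open>finite I\<close> e_sub(2) by (auto simp: D'_def intro!: finite_SigmaI)
  have disj: "W \<inter> \<phi> W i = {}" for W i by (auto simp: \<phi>_def)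
  have inj: "inj_on g D"
  proof (rule inj_on_inverseI)
    fix x assume "x \<in> D"
    show "(\<lambda>(Z, B, i). (Z - B, i)) (g x) = x"
      by (cases x) (use disj in \<open>auto simp: g_def\<close>)
  qed
  have gD: "g ` D \<subseteq> D'"
  proof
    fix y assume "y \<in> g ` D"
    then obtain W i where "W \<subseteq> X" "i \<in> I" "m \<le> card (\<phi> W i)" "y = (W \<union> \<phi> W i, \<phi> W i, i)"
      by (auto simp: D_def g_def)
    moreover from this have "W \<union> \<phi> W i \<subseteq> X" using \<phi>1 T(1) by blast
    ultimately show "y \<in> D'" using \<phi>1 \<phi>_e by (simp add: D'_def)
  qed
  have "subset_exp X p (\<lambda>W. real (card {i \<in> I. m \<le> card (\<phi> W i)}))
      = (\<Sum>W\<in>Pow X. \<Sum>i\<in>{i \<in> I. m \<le> card (\<phi> W i)}. \<mu> W)"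
    by (simp add: subset_exp_def \<mu>_def mult_ac)
  also have "\<dots> = (\<Sum>(W, i)\<in>D. \<mu> W)"
    unfolding D_def using \<open>finite X\<close> \<open>finite I\<close> by (subst sum.Sigma) auto
  also have "\<dots> \<le> (\<Sum>x\<in>D. (\<lambda>(Z, B, i). \<mu> Z / p ^ card B) (g x))"
  proof (rule sum_mono)
    fix x assume "x \<in> D"
    then obtain W i where x: "x = (W, i)" "W \<subseteq> X" "i \<in> I" by (auto simp: D_def)
    then have "\<phi> W i \<subseteq> X" using \<phi>1 T(1) by blast
    then show "(case x of (W, i) \<Rightarrow> \<mu> W) \<le> (case g x of (Z, B, i) \<Rightarrow> \<mu> Z / p ^ card B)"
      using \<mu>_shift[OF x(2) _ disj] x by (simp add: g_def)
  qed
  also have "\<dots> = (\<Sum>(Z, B, i)\<in>g ` D. \<mu> Z / p ^ card B)"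
    using inj by (simp add: sum.reindex)
  also have "\<dots> \<le> (\<Sum>(Z, B, i)\<in>D'. \<mu> Z / p ^ card B)"
    using finD' gD \<mu>0 p by (intro sum_mono2) (auto simp: less_imp_le)
  also have "\<dots> = (\<Sum>Z\<in>Pow X. \<Sum>B\<in>{B\<in>Pow (e Z). m \<le> card B}. \<Sum>i\<in>{i \<in> I. B \<subseteq> T i}. \<mu> Z / p ^ card B)"
    unfolding D'_def using \<open>finite X\<close> \<open>finite I\<close> e_sub(2)
    by (subst sum.Sigma[symmetric], simp, simp, subst sum.Sigma, auto)
  also have "\<dots> \<le> (\<Sum>Z\<in>Pow X. \<mu> Z * (2 ^ K * N / (p * r) ^ m))"
  proof (rule sum_mono)
    fix Z assume "Z \<in> Pow X"
    have "(\<Sum>B\<in>{B\<in>Pow (e Z). m \<le> card B}. \<Sum>i\<in>{i \<in> I. B \<subseteq> T i}. \<mu> Z / p ^ card B)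
        \<le> (\<Sum>B\<in>{B\<in>Pow (e Z). m \<le> card B}. \<mu> Z * (N / (p * r) ^ m))"
    proof (rule sum_mono)
      fix B assume B: "B \<in> {B\<in>Pow (e Z). m \<le> card B}"
      have "(\<Sum>i\<in>{i \<in> I. B \<subseteq> T i}. \<mu> Z / p ^ card B)
          = \<mu> Z * (real (card {i \<in> I. B \<subseteq> T i}) / p ^ card B)" by simp
      also have "\<dots> \<le> \<mu> Z * ((N / r ^ card B) / p ^ card B)"
        using B e_sub(1)[of Z] p \<mu>0 by (intro mult_left_mono divide_right_mono spread) auto
      also have "\<dots> = \<mu> Z * (N / (p * r) ^ card B)" by (simp add: power_mult_distrib mult.commute)
      also have "\<dots> \<le> \<mu> Z * (N / (p * r) ^ m)"
        using B N pr p r by (intro mult_left_mono divide_left_mono power_increasing \<mu>0) auto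
      finally show "(\<Sum>i\<in>{i \<in> I. B \<subseteq> T i}. \<mu> Z / p ^ card B) \<le> \<mu> Z * (N / (p * r) ^ m)" .
    qed
    also have "\<dots> = real (card {B\<in>Pow (e Z). m \<le> card B}) * (\<mu> Z * (N / (p * r) ^ m))" by simp
    also have "\<dots> \<le> 2 ^ K * (\<mu> Z * (N / (p * r) ^ m))"
    proof (rule mult_right_mono)
      have "card {B\<in>Pow (e Z). m \<le> card B} \<le> card (Pow (e Z))"
        using e_sub(2) by (intro card_mono) auto
      also have "\<dots> \<le> 2 ^ K" using e_sub by (simp add: card_Pow)
      finally show "real (card {B\<in>Pow (e Z). m \<le> card B}) \<le> 2 ^ K"
        by (metis of_nat_le_iff of_nat_numeral of_nat_power)
      show "0 \<le> \<mu> Z * (N / (p * r) ^ m)" using \<mu>0 N pr by simp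
    qed
    finally show "(\<Sum>B\<in>{B\<in>Pow (e Z). m \<le> card B}. \<Sum>i\<in>{i \<in> I. B \<subseteq> T i}. \<mu> Z / p ^ card B)
        \<le> \<mu> Z * (2 ^ K * N / (p * r) ^ m)" by (simp add: mult_ac)
  qed
  also have "\<dots> = subset_exp X p (\<lambda>_. 2 ^ K * N / (p * r) ^ m)"
    by (simp add: subset_exp_def \<mu>_def)
  also have "\<dots> = 2 ^ K * N / (p * r) ^ m"
    using \<open>finite X\<close> by (rule subset_exp_const)
  finally show thesis using that \<phi>1 \<phi>2 by blast
qed

text \<open>Induction on the number of rounds. After the first random set, members with a fragment
  of size at least \<open>2 ^ L\<close> are given up, and the induction hypothesis treats the
  fragments of the others. \<open>N\<close> stays fixed while the index set shrinks, hence the form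
  multiplied by \<open>card I\<close>; the bound sums losses \<open>N * (1/2) ^ j / 4\<close> over
  the rounds.\<close>

lemma spread_iteration:
  fixes T :: "'b \<Rightarrow> 'a set" and N p r :: real
  assumes "finite X" "finite I" and p: "0 < p" "p \<le> 1" and pr: "32 \<le> p * r"
    and T: "\<And>i. i \<in> I \<Longrightarrow> T i \<subseteq> X" "\<And>i. i \<in> I \<Longrightarrow> card (T i) < 2 ^ L"
    and spread: "\<And>A. A \<subseteq> X \<Longrightarrow> real (card {i \<in> I. A \<subseteq> T i}) \<le> N / r ^ card A"
  shows "real (card I) * subset_exp X (1 - (1 - p) ^ L) (\<lambda>W. of_bool (\<forall>i\<in>I. \<not> T i \<subseteq> W))
    \<le> N * (1 - (1/2) ^ L) / 4"
  using \<open>finite I\<close> T spread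
proof (induction L arbitrary: I T)
  case 0
  \<comment> \<open>Cardinality below \<open>2 ^ 0\<close> forces empty members, so the random set,
    empty at density 0, fails only if \<open>I\<close> is empty, and then
    \<open>card I = 0\<close>.\<close>
  have "T i = {}" if "i \<in> I" for i
    using 0(2,3)[OF that] \<open>finite X\<close> by (auto dest: finite_subset)
  then have "of_bool (\<forall>i\<in>I. \<not> T i \<subseteq> {}) = (of_bool (I = {}) :: real)" by auto
  then show ?case using \<open>finite X\<close> by (simp add: subset_exp_zero_prob)
next
  case (Suc L)
  let ?q = "1 - (1 - p) ^ L" and ?K = "2 ^ Suc L - 1 :: nat" and ?m = "2 ^ L :: nat"
  let ?fail = "\<lambda>W. of_bool (\<forall>i\<in>I. \<not> T i \<subseteq> W) :: real"
  have r: "0 < r" using p pr by (smt (verit) mult_nonneg_nonpos)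
  have N: "0 \<le> N" using Suc.prems(4)[of "{}"] by simp
  have q: "0 \<le> ?q" "?q \<le> 1" using p by (auto intro: power_le_one)
  have K: "card (T i) \<le> ?K" if "i \<in> I" for i
    using Suc.prems(3)[OF that] by linarith
  have pr1: "1 \<le> p * r" using pr by linarith
  obtain \<phi> where \<phi>: "\<And>W i. i \<in> I \<Longrightarrow> \<phi> W i \<subseteq> T i"
    "\<And>W i. i \<in> I \<Longrightarrow> \<exists>j\<in>I. T j \<subseteq> W \<union> \<phi> W i"
    and bad: "subset_exp X p (\<lambda>W. real (card {i \<in> I. ?m \<le> card (\<phi> W i)})) \<le> 2 ^ ?K * N / (p * r) ^ ?m"
    using fragment_bound[OF \<open>finite X\<close> Suc.prems(1) p pr1 Suc.prems(2) K Suc.prems(4), where m = ?m]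
    by blast
  \<comment> \<open>With the first random set \<open>V\<close> fixed, the kept indices
    \<open>J\<close> fall under the induction hypothesis and each of the others costs at most
    1.\<close>
  have step: "real (card I) * subset_exp X ?q (\<lambda>W. ?fail (V \<union> W))
      \<le> N * (1 - (1/2) ^ L) / 4 + real (card {i \<in> I. ?m \<le> card (\<phi> V i)})" for V
  proof -
    define J where "J = {i \<in> I. card (\<phi> V i) < ?m}"
    have "finite J" using Suc.prems(1) by (simp add: J_def)
    have cardI: "card I = card J + card {i \<in> I. ?m \<le> card (\<phi> V i)}"
    proof -
      have "I = J \<union> {i \<in> I. ?m \<le> card (\<phi> V i)}" by (auto simp: J_def)
      moreover have "card (J \<union> {i \<in> I. ?m \<le> card (\<phi> V i)}) = card J + card {i \<in> I. ?m \<le> card (\<phi> V i)}"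
        using Suc.prems(1) by (intro card_Un_disjoint) (auto simp: J_def)
      ultimately show ?thesis by simp
    qed
    have "real (card J) * subset_exp X ?q (\<lambda>W. of_bool (\<forall>i\<in>J. \<not> \<phi> V i \<subseteq> W))
        \<le> N * (1 - (1/2) ^ L) / 4"
    proof (rule Suc.IH[OF \<open>finite J\<close>])
      fix A assume A: "A \<subseteq> X"
      have "{i \<in> J. A \<subseteq> \<phi> V i} \<subseteq> {i \<in> I. A \<subseteq> T i}"
        using order_trans[OF _ \<phi>(1)] by (auto simp: J_def)
      then have "card {i \<in> J. A \<subseteq> \<phi> V i} \<le> card {i \<in> I. A \<subseteq> T i}"
        using Suc.prems(1) by (intro card_mono) auto
      then show "real (card {i \<in> J. A \<subseteq> \<phi> V i}) \<le> N / r ^ card A"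
        using Suc.prems(4)[OF A] by linarith
    qed (use order_trans[OF \<phi>(1) Suc.prems(2)] in \<open>auto simp: J_def\<close>)
    moreover have "subset_exp X ?q (\<lambda>W. ?fail (V \<union> W))
        \<le> subset_exp X ?q (\<lambda>W. of_bool (\<forall>i\<in>J. \<not> \<phi> V i \<subseteq> W))"
    proof (rule subset_exp_mono[OF q])
      fix W
      \<comment> \<open>A fragment covered by \<open>W\<close> yields a member covered by
        \<open>V \<union> W\<close>, so failure for the members implies failure for the
        fragments.\<close>
      have "\<exists>j\<in>I. T j \<subseteq> V \<union> W" if "i \<in> J" "\<phi> V i \<subseteq> W" for i
      proof -
        have "i \<in> I" using that by (simp add: J_def)
        from \<phi>(2)[OF this, of V] that(2) show ?thesis by blast
      qed
      then show "?fail (V \<union> W) \<le> of_bool (\<forall>i\<in>J. \<not> \<phi> V i \<subseteq> W)" by auto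
    qed
    ultimately have J: "real (card J) * subset_exp X ?q (\<lambda>W. ?fail (V \<union> W)) \<le> N * (1 - (1/2) ^ L) / 4"
      by (meson mult_left_mono of_nat_0_le_iff order_trans)
    have "subset_exp X ?q (\<lambda>W. ?fail (V \<union> W)) \<le> subset_exp X ?q (\<lambda>_. 1)"
      by (rule subset_exp_mono[OF q]) simp
    then have "subset_exp X ?q (\<lambda>W. ?fail (V \<union> W)) \<le> 1"
      using \<open>finite X\<close> by (simp add: subset_exp_const)
    then have "real (card {i \<in> I. ?m \<le> card (\<phi> V i)}) * subset_exp X ?q (\<lambda>W. ?fail (V \<union> W))
        \<le> real (card {i \<in> I. ?m \<le> card (\<phi> V i)})"
      by (rule mult_left_le) simp
    with J show ?thesis by (simp add: cardI distrib_right)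
  qed
  \<comment> \<open>\<open>?K = 2 * ?m - 1\<close> turns \<open>2 ^ ?K\<close> into
    \<open>4 ^ ?m / 2\<close>, and 32 makes \<open>4 / (p * r)\<close> at most
    \<open>1/4 * (1/2)\<close>. One factor 1/4 and \<open>Suc L\<close> factors 1/2, available since
    \<open>Suc L \<le> ?m\<close>, bring the loss down to the next term of the geometric
    sum.\<close>
  have num: "2 ^ ?K * N / (p * r) ^ ?m \<le> N * (1/2) ^ Suc L / 4"
  proof -
    have m: "Suc L \<le> ?m" by (rule Suc_leI[OF less_exp])
    have "(2::real) * 2 ^ ?K = 4 ^ ?m"
    proof -
      have "(2::real) * 2 ^ ?K = 2 ^ Suc ?K" by (simp only: power_Suc)
      also have "Suc ?K = 2 * ?m" by simp
      also have "(2::real) ^ (2 * ?m) = 4 ^ ?m" by (simp only: power_mult) simp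
      finally show ?thesis .
    qed
    then have K2: "(2::real) ^ ?K = 4 ^ ?m / 2" by linarith
    have e: "2 ^ ?K * N / (p * r) ^ ?m = (N / 2) * (4 ^ ?m / (p * r) ^ ?m)"
      unfolding K2 by simp
    have "4 ^ ?m / (p * r) ^ ?m = (4 / (p * r)) ^ ?m" by (simp add: power_divide)
    also have "\<dots> \<le> (1/4 * (1/2)) ^ ?m"
      using pr by (intro power_mono) (simp_all add: field_simps)
    also have "\<dots> = (1/4) ^ ?m * (1/2) ^ ?m" by (rule power_mult_distrib)
    also have "\<dots> \<le> (1/4) ^ 1 * (1/2) ^ Suc L"
      using m by (intro mult_mono power_decreasing) auto
    also have "\<dots> \<le> (1/2) ^ Suc L / 2" by (simp add: field_simps)
    finally have "4 ^ ?m / (p * r) ^ ?m \<le> (1/2) ^ Suc L / 2" .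
    then have "(N / 2) * (4 ^ ?m / (p * r) ^ ?m) \<le> (N / 2) * ((1/2) ^ Suc L / 2)"
      using N by (intro mult_left_mono) auto
    then show ?thesis unfolding e by simp
  qed
  have "real (card I) * subset_exp X (1 - (1 - p) ^ Suc L) ?fail
      = subset_exp X p (\<lambda>V. real (card I) * subset_exp X ?q (\<lambda>W. ?fail (V \<union> W)))"
    using subset_exp_Un[OF \<open>finite X\<close>, of p ?q ?fail] by (simp add: subset_exp_cmult)
  also have "\<dots> \<le> subset_exp X p
      (\<lambda>V. N * (1 - (1/2) ^ L) / 4 + real (card {i \<in> I. ?m \<le> card (\<phi> V i)}))"
    using p step by (intro subset_exp_mono) auto
  also have "\<dots> \<le> N * (1 - (1/2) ^ L) / 4 + N * (1/2) ^ Suc L / 4"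
    using order_trans[OF bad num]
    unfolding subset_exp_add subset_exp_const[OF \<open>finite X\<close>] by (rule add_left_mono)
  also have "\<dots> = N * (1 - (1/2) ^ Suc L) / 4" by (simp add: field_simps)
  finally show ?case .
qed

text \<open>The \<open>L\<close> independent rounds have density \<open>p\<close> with \<open>(1 - p) ^ L = 1/2\<close>, so their union is a
  uniformly random subset.\<close>

lemma spread_half:
  fixes G :: "'a set set"
  assumes "finite X" "G \<subseteq> Pow X" "G \<noteq> {}" "0 < L"
    and "\<And>A. A \<in> G \<Longrightarrow> card A < 2 ^ L"
    and r: "64 * real L \<le> r"
    and spread: "\<And>A. A \<subseteq> X \<Longrightarrow> real (card {B \<in> G. A \<subseteq> B}) \<le> 2 * real (card G) / r ^ card A"
  shows "subset_exp X (1/2) (\<lambda>W. of_bool (\<forall>A\<in>G. \<not> A \<subseteq> W)) < 1/2"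
proof -
  define p where "p = 1 - root L (1/2)"
  have root: "0 < root L (1/2)" "root L (1/2) < 1"
    using \<open>0 < L\<close> by auto
  have pow: "(1 - p) ^ L = 1/2" using \<open>0 < L\<close> by (simp add: p_def real_root_pow_pos)
  \<comment> \<open>Bernoulli's inequality leads to \<open>1 / (2 * real L) \<le> p\<close>, so
    \<open>64 * real L \<le> r\<close> yields the \<open>32 \<le> p * r\<close> of the
    iteration.\<close>
  have "1/2 \<le> (1 - 1 / (2 * real L)) ^ L"
  proof -
    have "1 + real L * (- 1 / (2 * real L)) \<le> (1 + (- 1 / (2 * real L))) ^ L"
      using \<open>0 < L\<close> by (intro Bernoulli_inequality) (simp add: field_simps)
    then show ?thesis using \<open>0 < L\<close> by simp
  qed
  then have "(1 - p) ^ L \<le> (1 - 1 / (2 * real L)) ^ L" by (simp add: pow)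
  then have "1 - p \<le> 1 - 1 / (2 * real L)"
    using \<open>0 < L\<close> power_le_imp_le_base[of "1 - p" "L - 1" "1 - 1 / (2 * real L)"]
    by (simp add: field_simps)
  then have "1 / (2 * real L) * (64 * real L) \<le> p * r"
    using r root by (intro mult_mono) (auto simp: p_def)
  then have pr: "32 \<le> p * r" using \<open>0 < L\<close> by simp
  have "finite G" using \<open>finite X\<close> \<open>G \<subseteq> Pow X\<close> finite_subset by blast
  then have c: "0 < real (card G)" using \<open>G \<noteq> {}\<close> by (simp add: card_gt_0_iff)
  have "real (card G) * subset_exp X (1 - (1 - p) ^ L) (\<lambda>W. of_bool (\<forall>A\<in>G. \<not> A \<subseteq> W))
      \<le> 2 * real (card G) * (1 - (1/2) ^ L) / 4"
    using assms root by (intro spread_iteration[OF \<open>finite X\<close> \<open>finite G\<close> _ _ pr]) (auto simp: p_def)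
  \<comment> \<open>Taking \<open>N = 2 * real (card G)\<close> leaves a failure probability of at
    most \<open>(1 - (1/2) ^ L) / 2\<close>, strictly below 1/2.\<close>
  also have "\<dots> < real (card G) * (1/2)"
    using c by (simp add: field_simps)
  finally show ?thesis using c unfolding pow by simp
qed

text \<open>If all pairs met, no \<open>W\<close> could contain a member of \<open>G\<close> while
  \<open>X - W\<close> contains one of \<open>H\<close>. The two failure events would then cover
  everything, yet each has probability below 1/2 because \<open>X - W\<close> is as uniform as
  \<open>W\<close>.\<close>

lemma spread_disjoint_members:
  fixes G H :: "'a set set"
  assumes "finite X" "0 < L" and r: "64 * real L \<le> r"
    and G: "G \<subseteq> Pow X" "G \<noteq> {}" "\<And>A. A \<in> G \<Longrightarrow> card A < 2 ^ L"
      "\<And>A. A \<subseteq> X \<Longrightarrow> real (card {B \<in> G. A \<subseteq> B}) \<le> 2 * real (card G) / r ^ card A"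
    and H: "H \<subseteq> Pow X" "H \<noteq> {}" "\<And>A. A \<in> H \<Longrightarrow> card A < 2 ^ L"
      "\<And>A. A \<subseteq> X \<Longrightarrow> real (card {B \<in> H. A \<subseteq> B}) \<le> 2 * real (card H) / r ^ card A"
  obtains A B where "A \<in> G" "B \<in> H" "A \<inter> B = {}"
proof (rule ccontr)
  assume "\<not> thesis"
  then have no: "A \<inter> B \<noteq> {}" if "A \<in> G" "B \<in> H" for A B
    using that \<open>\<And>A B. \<lbrakk>A \<in> G; B \<in> H; A \<inter> B = {}\<rbrakk> \<Longrightarrow> thesis\<close> by blast
  let ?f = "\<lambda>G W. of_bool (\<forall>A\<in>G. \<not> A \<subseteq> W) :: real"
  have "1 = subset_exp X (1/2) (\<lambda>_. 1)"
    using \<open>finite X\<close> by (simp add: subset_exp_const)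
  also have "\<dots> \<le> subset_exp X (1/2) (\<lambda>W. ?f G W + ?f H (X - W))"
  proof (rule subset_exp_mono)
    fix W
    show "1 \<le> ?f G W + ?f H (X - W)"
      using no by (auto split: if_splits)
  qed auto
  also have "\<dots> = subset_exp X (1/2) (?f G) + subset_exp X (1/2) (?f H)"
    using subset_exp_half_compl[OF \<open>finite X\<close>, of "?f H"] by (simp add: subset_exp_add)
  also have "\<dots> < 1/2 + 1/2"
    using spread_half[OF \<open>finite X\<close> G(1,2) \<open>0 < L\<close> G(3) r G(4)]
      spread_half[OF \<open>finite X\<close> H(1,2) \<open>0 < L\<close> H(3) r H(4)] by linarith
  finally show False by simp
qed

subsection \<open>Homogeneous families\<close>

lemma card_link: "card (link G S) = card {A \<in> G. S \<subseteq> A}"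
proof -
  have "link G S = (\<lambda>A. A - S) ` {A \<in> G. S \<subseteq> A}"
    by (auto simp: link_def)
  moreover have "inj_on (\<lambda>A. A - S) {A \<in> G. S \<subseteq> A}"
    by (rule inj_on_inverseI[of _ "\<lambda>A. A \<union> S"]) auto
  ultimately show ?thesis by (simp add: card_image)
qed

lemma link_link:
  assumes "A \<inter> S = {}"
  shows "link (link G S) A = link G (S \<union> A)"
proof (rule set_eqI)
  fix x
  have e: "A \<subseteq> B - S \<longleftrightarrow> A \<subseteq> B" "B - S - A = B - (S \<union> A)" for B
    using assms by auto
  have "x \<in> link (link G S) A \<longleftrightarrow> (\<exists>B. B \<in> G \<and> S \<subseteq> B \<and> A \<subseteq> B - S \<and> x = B - S - A)"
    unfolding link_def by blast
  then show "x \<in> link (link G S) A \<longleftrightarrow> x \<in> link G (S \<union> A)"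
    unfolding link_def[of G "S \<union> A"] e by auto
qed

text \<open>The ratio is the product of \<open>(m - i) / (N - i)\<close> over \<open>i < a\<close>,
  and each factor is at most \<open>m / N\<close> because \<open>m \<le> N\<close>.\<close>

lemma binomial_ratio_le:
  assumes "a \<le> m" "m \<le> N"
  shows "real ((N - a) choose (m - a)) / real (N choose m) \<le> (real m / real N) ^ a"
  using assms(1)
proof (induction a)
  case 0
  then show ?case by simp
next
  case (Suc a)
  have pos: "0 < real N - real a" "0 < real (N choose m)" "0 < real N"
    using Suc.prems assms(2) by auto
  have "(m - a) * ((N - a) choose (m - a)) = (N - a) * ((N - a - 1) choose (m - a - 1))"
    using Suc.prems by (intro times_binomial_minus1_eq) simp
  then have "(real m - real a) * real ((N - a) choose (m - a))
      = (real N - real a) * real ((N - Suc a) choose (m - Suc a))"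
    using Suc.prems assms(2) by (simp flip: of_nat_mult of_nat_diff)
  then have "real ((N - Suc a) choose (m - Suc a))
      = (real m - real a) / (real N - real a) * real ((N - a) choose (m - a))"
    using pos by (simp add: nonzero_eq_divide_eq mult.commute)
  then have "real ((N - Suc a) choose (m - Suc a)) / real (N choose m)
      = (real m - real a) / (real N - real a) * (real ((N - a) choose (m - a)) / real (N choose m))"
    by simp
  also have "\<dots> \<le> (real m / real N) * (real m / real N) ^ a"
  proof (intro mult_mono Suc.IH)
    show "(real m - real a) / (real N - real a) \<le> real m / real N"
      using pos assms(2) mult_right_mono[of "real m" "real N" "real a"] by (simp add: field_simps)
  qed (use Suc.prems in auto)
  finally show ?case by simp
qed

text \<open>Replaces the binomial quotient by a power and covers all sizes of \<open>A\<close>: a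
  set of more than \<open>m\<close> points lies in no member.\<close>

lemma homogeneous_superset_count:
  assumes hom: "homogeneous \<tau> Y m G" and "finite Y" "m \<le> card Y" "1 \<le> \<tau>" "A \<subseteq> Y"
    and \<rho>: "\<tau> * (real m / real (card Y)) \<le> \<rho>"
  shows "real (card {B \<in> G. A \<subseteq> B}) \<le> real (card G) * \<rho> ^ card A"
proof (cases "card A \<le> m")
  case True
  have "real (card {B \<in> G. A \<subseteq> B})
      \<le> \<tau> ^ card A * (real ((card Y - card A) choose (m - card A)) / real (card Y choose m)) * real (card G)"
    using hom True \<open>A \<subseteq> Y\<close> by (simp add: homogeneous_def card_link)
  also have "\<dots> \<le> \<tau> ^ card A * (real m / real (card Y)) ^ card A * real (card G)"
    using \<open>1 \<le> \<tau>\<close> by (intro mult_right_mono mult_left_mono binomial_ratio_le True \<open>m \<le> card Y\<close>) auto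
  also have "\<dots> = (\<tau> * (real m / real (card Y))) ^ card A * real (card G)"
    by (simp only: power_mult_distrib)
  also have "\<dots> \<le> \<rho> ^ card A * real (card G)"
    using \<rho> \<open>1 \<le> \<tau>\<close> by (intro mult_right_mono power_mono) auto
  finally show ?thesis by (simp add: mult.commute)
next
  case False
  have "\<not> A \<subseteq> B" if "B \<in> G" for B
  proof
    assume "A \<subseteq> B"
    have "B \<subseteq> Y" "card B = m" using hom that by (auto simp: homogeneous_def nsets_def)
    then show False using False \<open>A \<subseteq> B\<close> \<open>finite Y\<close> by (metis card_mono finite_subset)
  qed
  then have none: "{B \<in> G. A \<subseteq> B} = {}" by blast
  have "0 \<le> \<rho>" using \<rho> \<open>1 \<le> \<tau>\<close> by (smt (verit) divide_nonneg_nonneg mult_nonneg_nonneg of_nat_0_le_iff)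
  then show ?thesis unfolding none by simp
qed

section \<open>Kernels with homogeneous links\<close>

text \<open>For a largest \<open>B\<close> of excess density, every \<open>B \<union> A\<close> with
  \<open>A\<close> nonempty falls below its threshold; dividing by the threshold that
  \<open>B\<close> meets gives homogeneity of the link. The size bound compares the density at
  \<open>B\<close> with the number of all sets available to the link.\<close>

lemma maximal_link_homogeneous:
  fixes F :: "'a set set"
  assumes "finite X" "F \<subseteq> nsets X k" "F \<noteq> {}" "k \<le> card X" "1 \<le> \<tau>"
  obtains B where "B \<subseteq> X" "card B \<le> k" "{A \<in> F. B \<subseteq> A} \<noteq> {}"
    "homogeneous \<tau> (X - B) (k - card B) (link {A \<in> F. B \<subseteq> A} B)"
    "real (card F) * \<tau> ^ card B \<le> real (card X choose k)"
proof -
  let ?n = "card X"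
  \<comment> \<open>\<open>\<tau> ^ b\<close> times the fraction of all \<open>k\<close>-subsets of
    \<open>X\<close> that contain a given \<open>b\<close>-set.\<close>
  define w where "w b = \<tau> ^ b * (real ((?n - b) choose (k - b)) / real (?n choose k))" for b
  define P where "P B \<longleftrightarrow> B \<subseteq> X \<and> card B \<le> k \<and> w (card B) * real (card F) \<le> real (card {A \<in> F. B \<subseteq> A})" for B
  have "finite F" using assms finite_imp_finite_nsets finite_subset by blast
  then have cF: "0 < real (card F)" using \<open>F \<noteq> {}\<close> by (simp add: card_gt_0_iff)
  have nk: "0 < real (?n choose k)" using assms by simp
  have wpos: "0 < w b" if "b \<le> k" for b
    using that assms by (simp add: w_def)
  have "P {}" using nk by (simp add: P_def w_def)
  moreover have "\<forall>C. P C \<longrightarrow> card C < Suc k" by (auto simp: P_def)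
  ultimately obtain B where B: "P B" and max: "\<And>C. P C \<Longrightarrow> card C \<le> card B"
    using ex_has_greatest_nat[of P "{}" card "Suc k"] by blast
  define G where "G = {A \<in> F. B \<subseteq> A}"
  have BX: "B \<subseteq> X" "card B \<le> k" "finite B" and BG: "w (card B) * real (card F) \<le> real (card G)"
    using B \<open>finite X\<close> by (auto simp: P_def G_def intro: finite_subset)
  have GX: "link G B \<subseteq> nsets (X - B) (k - card B)"
    using \<open>F \<subseteq> nsets X k\<close> BX(3) by (auto simp: link_def G_def nsets_def card_Diff_subset)
  have cXB: "card (X - B) = ?n - card B" using BX by (simp add: card_Diff_subset)
  have cG: "card (link G B) = card G" unfolding card_link by (rule arg_cong[of _ _ card]) (auto simp: G_def)
  have hom: "homogeneous \<tau> (X - B) (k - card B) (link G B)"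
    unfolding homogeneous_def
  proof (intro conjI allI impI GX)
    fix A assume A: "A \<subseteq> X - B \<and> card A \<le> k - card B"
    then have finA: "finite A" using \<open>finite X\<close> by (meson finite_Diff finite_subset)
    have cBA: "card (B \<union> A) = card B + card A" using A BX finA by (intro card_Un_disjoint) auto
    have dis: "A \<inter> B = {}" using A by blast
    have cL: "card (link (link G B) A) = card {C \<in> F. B \<union> A \<subseteq> C}"
      unfolding link_link[OF dis] card_link
      by (rule arg_cong[of _ _ card]) (auto simp: G_def)
    define h where "h = \<tau> ^ card A * (real ((?n - card B - card A) choose (k - card B - card A)) / real ((?n - card B) choose (k - card B)))"
    have nb: "0 < real ((?n - card B) choose (k - card B))" using BX assms by simp
    have "real (card {C \<in> F. B \<union> A \<subseteq> C}) \<le> h * real (card G)"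
    \<comment> \<open>Maximality only speaks about proper enlargements of \<open>B\<close>; for
      \<open>A = {}\<close> the factor \<open>h\<close> is 1.\<close>
    proof (cases "A = {}")
      case True
      then show ?thesis using nb by (simp add: h_def G_def)
    next
      case False
      then have "0 < card A" using finA by (simp add: card_gt_0_iff)
      then have "\<not> P (B \<union> A)" using max[of "B \<union> A"] cBA by auto
      then have "real (card {C \<in> F. B \<union> A \<subseteq> C}) \<le> w (card B + card A) * real (card F)"
        using A BX cBA by (auto simp: P_def)
      also have "w (card B + card A) = h * w (card B)"
        using nb by (simp add: w_def h_def power_add)
      also have "h * w (card B) * real (card F) = h * (w (card B) * real (card F))" by simp
      also have "\<dots> \<le> h * real (card G)"
        using \<open>1 \<le> \<tau>\<close> by (intro mult_left_mono BG) (simp add: h_def)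
      finally show ?thesis .
    qed
    then show "real (card (link (link G B) A)) \<le> \<tau> ^ card A *
        (real ((card (X - B) - card A) choose (k - card B - card A)) / real (card (X - B) choose (k - card B))) *
        real (card (link G B))"
      unfolding cL cG cXB h_def .
  qed
  have "0 < w (card B) * real (card F)" using wpos[OF BX(2)] cF by simp
  then have ne: "G \<noteq> {}" using BG by auto
  have "card G \<le> (?n - card B) choose (k - card B)"
  proof -
    have "card (link G B) \<le> card (nsets (X - B) (k - card B))"
      using GX \<open>finite X\<close> by (intro card_mono finite_imp_finite_nsets) auto
    then show ?thesis by (simp add: cG card_nsets cXB)
  qed
  then have "w (card B) * real (card F) \<le> real ((?n - card B) choose (k - card B))"
    using BG by linarith
  moreover have "0 < real ((?n - card B) choose (k - card B))" using BX assms by simp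
  ultimately have "real (card F) * \<tau> ^ card B \<le> real (?n choose k)"
    using nk by (simp add: w_def field_simps)
  then show thesis using that BX ne hom unfolding G_def by blast
qed

text \<open>Induction over proper subfamilies: since \<open>B\<close> lies in some member, removing
  the members above it shrinks \<open>F\<close>. Nonempty links are recorded because the comparison
  of two kernels needs members to choose from.\<close>

lemma greedy_decomposition:
  fixes F :: "'a set set"
  assumes "finite X" "F \<subseteq> nsets X k" "k \<le> card X" "1 \<le> \<tau>"
  shows "\<exists>S F'. F' \<subseteq> F \<and> (\<forall>A\<in>F - F'. \<exists>B\<in>S. B \<subseteq> A) \<and>
    (\<forall>B\<in>S. B \<subseteq> X \<and> card B \<le> q \<and> card B \<le> k \<and>
      (\<exists>G\<subseteq>F. link G B \<noteq> {} \<and> homogeneous \<tau> (X - B) (k - card B) (link G B))) \<and>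
    real (card F') * \<tau> ^ Suc q \<le> real (card X choose k)"
proof -
  have "finite F" using assms finite_imp_finite_nsets finite_subset by blast
  then show ?thesis using \<open>F \<subseteq> nsets X k\<close>
  proof (induction F rule: finite_psubset_induct)
    case (psubset F)
    show ?case
    proof (cases "F = {}")
      case True
      then show ?thesis by (intro exI[of _ "{}"]) simp
    next
      case False
      obtain B where B: "B \<subseteq> X" "card B \<le> k" "{A \<in> F. B \<subseteq> A} \<noteq> {}"
          "homogeneous \<tau> (X - B) (k - card B) (link {A \<in> F. B \<subseteq> A} B)"
          "real (card F) * \<tau> ^ card B \<le> real (card X choose k)"
        using maximal_link_homogeneous[OF \<open>finite X\<close> psubset.prems False assms(3,4)] .
      show ?thesis
      proof (cases "card B \<le> q")
        case False
        then have "real (card F) * \<tau> ^ Suc q \<le> real (card F) * \<tau> ^ card B"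
          using \<open>1 \<le> \<tau>\<close> by (intro mult_left_mono power_increasing) auto
        then show ?thesis using B(5) by (intro exI[of _ "{}"] exI[of _ F]) auto
      next
        case True
        have psub: "F - {A \<in> F. B \<subseteq> A} \<subset> F" using B(3) by blast
        have sub: "F - {A \<in> F. B \<subseteq> A} \<subseteq> nsets X k" using psubset.prems by blast
        obtain S F' where S: "F' \<subseteq> F - {A \<in> F. B \<subseteq> A}"
          "\<forall>A\<in>F - {A \<in> F. B \<subseteq> A} - F'. \<exists>B\<in>S. B \<subseteq> A"
          "\<forall>C\<in>S. C \<subseteq> X \<and> card C \<le> q \<and> card C \<le> k \<and>
            (\<exists>G\<subseteq>F - {A \<in> F. B \<subseteq> A}. link G C \<noteq> {} \<and> homogeneous \<tau> (X - C) (k - card C) (link G C))"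
          "real (card F') * \<tau> ^ Suc q \<le> real (card X choose k)"
          using psubset.IH[OF psub sub] by (elim exE conjE) (rule that)
        have "link {A \<in> F. B \<subseteq> A} B \<noteq> {}" using B(3) by (auto simp: link_def)
        then have hB: "\<exists>G\<subseteq>F. link G B \<noteq> {} \<and> homogeneous \<tau> (X - B) (k - card B) (link G B)"
          using B(4) by (intro exI[of _ "{A \<in> F. B \<subseteq> A}"]) auto
        have "F' \<subseteq> F" using S(1) by blast
        moreover have "\<forall>A\<in>F - F'. \<exists>C\<in>insert B S. C \<subseteq> A" using S(2) by auto
        moreover have "\<forall>C\<in>insert B S. C \<subseteq> X \<and> card C \<le> q \<and> card C \<le> k \<and>
            (\<exists>G\<subseteq>F. link G C \<noteq> {} \<and> homogeneous \<tau> (X - C) (k - card C) (link G C))"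
        proof
          fix C assume C: "C \<in> insert B S"
          show "C \<subseteq> X \<and> card C \<le> q \<and> card C \<le> k \<and>
            (\<exists>G\<subseteq>F. link G C \<noteq> {} \<and> homogeneous \<tau> (X - C) (k - card C) (link G C))"
          proof (cases "C = B")
            case False
            then show ?thesis using S(3) C by (meson Diff_subset insertE subset_trans)
          qed (use hB B(1,2) True in simp)
        qed
        ultimately show ?thesis using S(4)
          by (intro exI[of _ "insert B S"] exI[of _ F'] conjI)
      qed
    qed
  qed
qed

section \<open>Intersections of kernels\<close>

text \<open>By a union bound over the points of \<open>C\<close>, at most half of \<open>G\<close>
  meets \<open>C\<close>. The factor 2 in the spread bound pays for the members lost.\<close>

lemma spread_avoiding:
  fixes G :: "'a set set"
  assumes "finite G" "G \<noteq> {}" "finite C" and \<rho>: "real (card C) * \<rho> \<le> 1/2" "0 \<le> \<rho>"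
    and spread: "\<And>A. A \<subseteq> X \<Longrightarrow> real (card {B \<in> G. A \<subseteq> B}) \<le> real (card G) * \<rho> ^ card A"
    and "C \<subseteq> X"
  defines "G' \<equiv> {A \<in> G. A \<inter> C = {}}"
  shows "G' \<noteq> {}"
    and "\<And>A. A \<subseteq> X \<Longrightarrow> real (card {B \<in> G'. A \<subseteq> B}) \<le> 2 * real (card G') * \<rho> ^ card A"
proof -
  have "G - G' = (\<Union>x\<in>C. {B \<in> G. {x} \<subseteq> B})" by (auto simp: G'_def)
  then have "card (G - G') \<le> (\<Sum>x\<in>C. card {B \<in> G. {x} \<subseteq> B})"
    using card_UN_le[OF \<open>finite C\<close>] by metis
  then have "real (card (G - G')) \<le> real (\<Sum>x\<in>C. card {B \<in> G. {x} \<subseteq> B})"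
    by (rule of_nat_mono)
  also have "\<dots> = (\<Sum>x\<in>C. real (card {B \<in> G. {x} \<subseteq> B}))" by (rule of_nat_sum)
  also have "\<dots> \<le> (\<Sum>x\<in>C. real (card G) * \<rho>)"
  proof (rule sum_mono)
    fix x assume "x \<in> C"
    then show "real (card {B \<in> G. {x} \<subseteq> B}) \<le> real (card G) * \<rho>"
      using spread[of "{x}"] \<open>C \<subseteq> X\<close> by auto
  qed
  also have "\<dots> = real (card G) * (real (card C) * \<rho>)" by simp
  also have "\<dots> \<le> real (card G) * (1/2)" using \<rho> by (intro mult_left_mono) auto
  finally have "real (card (G - G')) \<le> real (card G) / 2" by simp
  moreover have "card (G - G') = card G - card G'" "card G' \<le> card G"
    using \<open>finite G\<close> by (auto simp: G'_def intro!: card_Diff_subset card_mono)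
  ultimately have half: "real (card G) \<le> 2 * real (card G')" by simp
  have "0 < card G" using \<open>finite G\<close> \<open>G \<noteq> {}\<close> by (simp add: card_gt_0_iff)
  then show "G' \<noteq> {}" using half by auto
  fix A assume A: "A \<subseteq> X"
  have "card {B \<in> G'. A \<subseteq> B} \<le> card {B \<in> G. A \<subseteq> B}"
    using \<open>finite G\<close> by (intro card_mono) (auto simp: G'_def)
  then have "real (card {B \<in> G'. A \<subseteq> B}) \<le> real (card G) * \<rho> ^ card A" using spread[OF A] by linarith
  also have "\<dots> \<le> 2 * real (card G') * \<rho> ^ card A"
    using half \<rho> by (intro mult_right_mono) auto
  finally show "real (card {B \<in> G'. A \<subseteq> B}) \<le> 2 * real (card G') * \<rho> ^ card A" .
qed

text \<open>The links thinned to avoid the opposite kernel contain disjoint \<open>A\<close> and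
  \<open>C\<close>; then the members \<open>A \<union> B 0\<close> and \<open>C \<union> B 1\<close>
  of \<open>F\<close> meet exactly in \<open>B 0 \<inter> B 1\<close>. Indexing by 0 and 1, with
  \<open>1 - i\<close> for the other kernel, treats both sides at once.\<close>

lemma homogeneous_kernels_intersect:
  fixes F :: "'a set set"
  assumes "finite X" "t_intersecting t F" "1 \<le> \<tau>" "0 < L" "k < 2 ^ L" "0 < k" "k \<le> card X"
    and n1: "64 * real L * \<tau> * real k \<le> real (card X)"
    and n2: "2 * real q * \<tau> * real k \<le> real (card X)"
    and B: "\<And>i. i \<in> {0, 1::nat} \<Longrightarrow> B i \<subseteq> X" "\<And>i. i \<in> {0, 1} \<Longrightarrow> card (B i) \<le> q"
      "\<And>i. i \<in> {0, 1} \<Longrightarrow> card (B i) \<le> k"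
    and G: "\<And>i. i \<in> {0, 1} \<Longrightarrow> G i \<subseteq> F" "\<And>i. i \<in> {0, 1} \<Longrightarrow> link (G i) (B i) \<noteq> {}"
      "\<And>i. i \<in> {0, 1} \<Longrightarrow> homogeneous \<tau> (X - B i) (k - card (B i)) (link (G i) (B i))"
  shows "t \<le> card (B 0 \<inter> B 1)"
proof -
  let ?n = "card X"
  \<comment> \<open>In terms of \<open>\<rho>\<close>, \<open>n1\<close> reads
    \<open>64 * real L \<le> 1 / \<rho>\<close> and \<open>n2\<close> reads
    \<open>real q * \<rho> \<le> 1/2\<close>.\<close>
  define \<rho> where "\<rho> = \<tau> * (real k / real ?n)"
  have n: "0 < real ?n" using assms by linarith
  have \<rho>pos: "0 < \<rho>" using assms n by (simp add: \<rho>_def)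
  define H where "H i = {A \<in> link (G i) (B i). A \<inter> B (1 - i) = {}}" for i
  have r: "64 * real L \<le> 1 / \<rho>"
    using n1 n assms by (simp add: \<rho>_def field_simps)
  have H: "H i \<subseteq> Pow X" "H i \<noteq> {}" "\<And>A. A \<in> H i \<Longrightarrow> card A < 2 ^ L"
    "\<And>A. A \<in> H i \<Longrightarrow> A \<inter> B i = {} \<and> A \<inter> B (1 - i) = {} \<and> A \<union> B i \<in> F"
    "\<And>A. A \<subseteq> X \<Longrightarrow> real (card {C \<in> H i. A \<subseteq> C}) \<le> 2 * real (card (H i)) / (1 / \<rho>) ^ card A"
    if i: "i \<in> {0, 1::nat}" for i
  proof -
    let ?G = "link (G i) (B i)"
    have i': "1 - i \<in> {0, 1}" using i by auto
    have finB: "finite (B i)" "finite (B (1 - i))" using B(1)[OF i] B(1)[OF i'] \<open>finite X\<close> finite_subset by blast+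
    have cXB: "card (X - B i) = ?n - card (B i)" using B(1)[OF i] finB by (simp add: card_Diff_subset)
    have GX: "?G \<subseteq> nsets (X - B i) (k - card (B i))" using G(3)[OF i] by (simp add: homogeneous_def)
    then have "finite ?G" using \<open>finite X\<close> by (meson finite_Diff finite_imp_finite_nsets finite_subset)
    have rat: "\<tau> * (real (k - card (B i)) / real (card (X - B i))) \<le> \<rho>"
    proof -
      have "real (k - card (B i)) / real (?n - card (B i)) \<le> real k / real ?n"
      \<comment> \<open>When \<open>card (B i)\<close> reaches \<open>?n\<close>, the left side
        divides by 0 and is therefore 0.\<close>
      proof (cases "card (B i) < ?n")
        case True
        have "real (k - card (B i)) * real ?n \<le> real k * real (?n - card (B i))"
          using B(3)[OF i] True \<open>k \<le> ?n\<close> mult_right_mono[of "real k" "real ?n" "real (card (B i))"]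
          by (simp add: of_nat_diff algebra_simps)
        then show ?thesis using True n by (simp add: divide_simps mult.commute)
      qed (use n in simp)
      then show ?thesis unfolding \<rho>_def cXB using \<open>1 \<le> \<tau>\<close> by (intro mult_left_mono) auto
    qed
    have sp: "real (card {C \<in> ?G. A \<subseteq> C}) \<le> real (card ?G) * \<rho> ^ card A" if "A \<subseteq> X" for A
    proof (cases "A \<subseteq> X - B i")
      case True
      then show ?thesis
        using G(3)[OF i] \<open>finite X\<close> \<open>k \<le> ?n\<close> \<open>1 \<le> \<tau>\<close> rat
        by (intro homogeneous_superset_count) (auto simp: cXB)
    next
      case False
      then have none: "{C \<in> ?G. A \<subseteq> C} = {}" using GX that by (auto simp: nsets_def)
      show ?thesis unfolding none using \<rho>pos by simp
    qed
    have "real (card (B (1 - i))) * \<rho> \<le> real q * \<rho>"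
      using B(2)[OF i'] \<rho>pos by (intro mult_right_mono) auto
    also have "\<dots> \<le> 1/2" using n2 n by (simp add: \<rho>_def field_simps)
    finally have "real (card (B (1 - i))) * \<rho> \<le> 1/2" .
    note * = spread_avoiding[OF \<open>finite ?G\<close> G(2)[OF i] finB(2) this less_imp_le[OF \<rho>pos] sp B(1)[OF i'], folded H_def]
    show "H i \<noteq> {}" using * by blast
    show "real (card {C \<in> H i. A \<subseteq> C}) \<le> 2 * real (card (H i)) / (1 / \<rho>) ^ card A" if "A \<subseteq> X" for A
      using *(2)[of A] that by (simp add: power_divide)
    show "H i \<subseteq> Pow X" using GX by (auto simp: H_def nsets_def)
    show "card A < 2 ^ L" if "A \<in> H i" for A
      using GX that \<open>k < 2 ^ L\<close> by (auto simp: H_def nsets_def)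
    show "A \<inter> B i = {} \<and> A \<inter> B (1 - i) = {} \<and> A \<union> B i \<in> F" if "A \<in> H i" for A
    proof -
      from that obtain C where C: "C \<in> G i" "B i \<subseteq> C" "A = C - B i" "A \<inter> B (1 - i) = {}"
        by (auto simp: H_def link_def)
      moreover have "A \<union> B i = C" using C by blast
      ultimately show ?thesis using G(1)[OF i] by auto
    qed
  qed
  have 01: "0 \<in> {0, 1::nat}" "1 \<in> {0, 1::nat}" by auto
  obtain A C where AC: "A \<in> H 0" "C \<in> H 1" "A \<inter> C = {}"
    by (rule spread_disjoint_members[OF \<open>finite X\<close> \<open>0 < L\<close> r
        H(1-3)[OF 01(1)] H(5)[OF 01(1)] H(1-3)[OF 01(2)] H(5)[OF 01(2)]])
  have "A \<union> B 0 \<in> F" "C \<union> B 1 \<in> F" "A \<inter> B 1 = {}" "C \<inter> B 0 = {}"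
    using H(4)[OF 01(1) AC(1)] H(4)[OF 01(2) AC(2)] by auto
  moreover have "(A \<union> B 0) \<inter> (C \<union> B 1) = B 0 \<inter> B 1"
    using AC(3) calculation by blast
  ultimately show ?thesis using \<open>t_intersecting t F\<close> by (metis t_intersecting_def)
qed

section \<open>Number of rounds and assembly\<close>

theorem theorem5:
  fixes n k t q :: nat and \<tau> :: real and F :: "nat set set"
  assumes "n \<ge> 2" and "k \<ge> 2" and "t \<ge> 1"
    and "F \<subseteq> nsets {1..n} k"
    and "t_intersecting t F"
    and "q \<ge> 1" and "\<tau> \<ge> 1"
    and "real n > 2 ^ 12 * \<tau> * real k * log 2 (2 * real k)"
    and "real n \<ge> 2 * real q * \<tau> * real k"
    and "q \<ge> t"
  shows "\<exists>S F'.
           S \<subseteq> Pow {1..n} \<and> t_intersecting t S \<and> (\<forall>B\<in>S. card B \<le> q) \<and>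
           F' \<subseteq> Pow {1..n} \<and>
           (\<forall>A\<in>F - F'. \<exists>B\<in>S. B \<subseteq> A) \<and>
           (\<forall>B\<in>S. \<exists>F\<^sub>B \<subseteq> F. homogeneous \<tau> ({1..n} - B) (k - card B) (link F\<^sub>B B)) \<and>
           real (card F') \<le> \<tau> powi (- int q - 1) * real (n choose k)"
proof -
  let ?X = "{1..n}"
  \<comment> \<open>\<open>2 ^ L\<close> is the least power of 2 above \<open>k\<close>; as
    \<open>L\<close> is at most \<open>log 2 (2 * real k)\<close>, the logarithmic bound on
    \<open>n\<close> allows for \<open>L\<close> rounds.\<close>
  define L where "L = Suc (nat \<lfloor>log 2 (real k)\<rfloor>)"
  have "0 < L" by (simp add: L_def)
  have log0: "0 \<le> log 2 (real k)" using \<open>k \<ge> 2\<close> by simp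
  have log2k: "log 2 (2 * real k) = 1 + log 2 (real k)" using \<open>k \<ge> 2\<close> by (simp add: log_mult)
  have L: "real L \<le> log 2 (2 * real k)" "log 2 (real k) < real L"
    unfolding log2k L_def using log0 by (simp_all, linarith+)
  have kL: "k < 2 ^ L"
  proof -
    have "real k < 2 powr real L" using L(2) \<open>k \<ge> 2\<close> by (simp add: log_less_iff)
    then have "real k < real (2 ^ L)" by (simp add: powr_realpow)
    then show ?thesis by (simp only: of_nat_less_iff)
  qed
  have tk: "1 \<le> \<tau> * real k" using \<open>\<tau> \<ge> 1\<close> \<open>k \<ge> 2\<close> mult_mono[of 1 \<tau> 1 "real k"] by simp
  have n1: "64 * real L * \<tau> * real k \<le> real n"
  proof -
    have "64 * real L * (\<tau> * real k) \<le> 2 ^ 12 * log 2 (2 * real k) * (\<tau> * real k)"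
      using L(1) tk by (intro mult_right_mono) auto
    then show ?thesis using assms(8) by (simp add: mult_ac)
  qed
  have kn: "k \<le> n"
  proof -
    have "1 * real k \<le> (64 * real L * \<tau>) * real k"
      using \<open>\<tau> \<ge> 1\<close> \<open>0 < L\<close> mult_mono[of 1 "64 * real L" 1 \<tau>] by (intro mult_right_mono) auto
    then show ?thesis using n1 by linarith
  qed
  obtain S F' where S: "F' \<subseteq> F" "\<forall>A\<in>F - F'. \<exists>B\<in>S. B \<subseteq> A"
    and SB: "\<forall>B\<in>S. B \<subseteq> ?X \<and> card B \<le> q \<and> card B \<le> k \<and>
      (\<exists>G\<subseteq>F. link G B \<noteq> {} \<and> homogeneous \<tau> (?X - B) (k - card B) (link G B))"
    and F': "real (card F') * \<tau> ^ Suc q \<le> real (n choose k)"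
    using greedy_decomposition[OF _ assms(4) _ \<open>\<tau> \<ge> 1\<close>, of q] kn by auto
  have "t_intersecting t S"
    unfolding t_intersecting_def
  proof (intro ballI)
    fix B C assume "B \<in> S" "C \<in> S"
    obtain G H where GH: "G \<subseteq> F" "link G B \<noteq> {}" "homogeneous \<tau> (?X - B) (k - card B) (link G B)"
      "H \<subseteq> F" "link H C \<noteq> {}" "homogeneous \<tau> (?X - C) (k - card C) (link H C)"
      using SB \<open>B \<in> S\<close> \<open>C \<in> S\<close> by meson
    \<comment> \<open>The conditional presents the pair as a function on 0 and 1;
      \<open>B = C\<close> is allowed, as \<open>t_intersecting\<close> also compares a set with
      itself.\<close>
    have "t \<le> card ((if (0::nat) = 0 then B else C) \<inter> (if (1::nat) = 0 then B else C))"
      by (rule homogeneous_kernels_intersect[where X = ?X and F = F and L = L and k = k and \<tau> = \<tau>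
            and q = q and G = "\<lambda>i. if i = 0 then G else H"])
        (use GH SB \<open>B \<in> S\<close> \<open>C \<in> S\<close> \<open>0 < L\<close> kL kn n1 assms in \<open>auto split: if_splits\<close>)
    then show "t \<le> card (B \<inter> C)" by simp
  qed
  moreover have "F' \<subseteq> Pow ?X" using S(1) assms(4) by (auto simp: nsets_def)
  moreover have "real (card F') \<le> \<tau> powi (- int q - 1) * real (n choose k)"
  proof -
    have "- int q - 1 = - int (Suc q)" by simp
    then have "\<tau> powi (- int q - 1) = inverse (\<tau> ^ Suc q)"
      by (simp only: power_int_minus power_int_of_nat)
    then have "\<tau> powi (- int q - 1) * real (n choose k) = real (n choose k) / \<tau> ^ Suc q"
      by (simp only: divide_inverse mult.commute)
    then show ?thesis using F' \<open>\<tau> \<ge> 1\<close> by (simp only: pos_le_divide_eq zero_less_power)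
  qed
  moreover have "S \<subseteq> Pow ?X" "\<forall>B\<in>S. card B \<le> q"
    "\<forall>B\<in>S. \<exists>F\<^sub>B \<subseteq> F. homogeneous \<tau> (?X - B) (k - card B) (link F\<^sub>B B)"
    using SB by blast+
  ultimately show ?thesis using S(2) by (intro exI[of _ S] exI[of _ F'] conjI)
qed

end
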